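(* Let $G\in\mathcal{G}_n^{sc}$ with Hermitian adjacency matrix $A$ and walk-matrix $W=[e,Ae,\ldots,A^{n-1}e]$ such that $\det W\neq0$. Let $U\in\mathscr{U}_G$ have level $\ell=\ell(U)$. For any odd Gaussian prime $p$, if $p^2\nmid\det W$ then $p\nmid\ell$.
   Context: A mixed graph is obtained from a simple undirected graph by orienting a subset of edges; $\mathcal{G}_n$ is the set of mixed graphs on $[n]$. The Hermitian adjacency matrix $A(G)=(a_{u,v})$ has $a_{u,v}=1$ for an undirected edge $uv$, $i$ for a directed edge $u\to v$, $-i$ for a directed edge $v\to u$, $0$ otherwise. $G$ is self-converse if isomorphic to the mixed graph obtained by reversing every directed edge; $\mathcal{G}_n^{sc}$ is the set of self-converse mixed graphs on $[n]$. $e$ is the all-one vector. A Gaussian integer $z$ is odd if $\mathrm{Re}(z)-\mathrm{Im}(z)$ is odd and even otherwise (so the odd Gaussian primes are exactly those not associate to $1+i$). Let $\Gamma=\{z\in\mathbb{Z}[i]:\mathrm{Re}(z)>0,\mathrm{Im}(z)\ge0\}$. For a Gaussian rational unitary matrix $U$, the level $\ell(U)$ is the unique $\ell\in\Gamma$ with $\ell U$ Gaussian integral and $N(\ell)=|\ell|^2$ minimal. $\mathscr{U}_G$ is the set of Gaussian rational unitary matrices $U$ with $Ue=e$ and $U^*A(G)U=A(H)$ for some $H\in\mathcal{G}_n^{sc}$. *)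

theory Defs
  imports Complex_Main "HOL-Computational_Algebra.Factorial_Ring"
    "Jordan_Normal_Form.Schur_Decomposition"
begin

section \<open>Gaussian integers\<close>

datatype gauss_int = Gauss_Int (gRe: int) (gIm: int)

lemma gauss_int_eq_iff: "x = y \<longleftrightarrow> gRe x = gRe y \<and> gIm x = gIm y"
  by (cases x; cases y) auto

instantiation gauss_int :: idom
begin

definition zero_gauss_int :: gauss_int where
  "0 = Gauss_Int 0 0"

definition one_gauss_int :: gauss_int where
  "1 = Gauss_Int 1 0"

definition plus_gauss_int :: "gauss_int \<Rightarrow> gauss_int \<Rightarrow> gauss_int" where
  "x + y = Gauss_Int (gRe x + gRe y) (gIm x + gIm y)"

definition uminus_gauss_int :: "gauss_int \<Rightarrow> gauss_int" where
  "- x = Gauss_Int (- gRe x) (- gIm x)"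

definition minus_gauss_int :: "gauss_int \<Rightarrow> gauss_int \<Rightarrow> gauss_int" where
  "x - y = Gauss_Int (gRe x - gRe y) (gIm x - gIm y)"

definition times_gauss_int :: "gauss_int \<Rightarrow> gauss_int \<Rightarrow> gauss_int" where
  "x * y = Gauss_Int (gRe x * gRe y - gIm x * gIm y) (gRe x * gIm y + gIm x * gRe y)"

lemmas gauss_int_ops = zero_gauss_int_def one_gauss_int_def plus_gauss_int_def
  uminus_gauss_int_def minus_gauss_int_def times_gauss_int_def

instance
proof
  fix x y :: gauss_int
  assume x: "x \<noteq> 0" and y: "y \<noteq> 0"
  have "(gRe (x * y))\<^sup>2 + (gIm (x * y))\<^sup>2
      = ((gRe x)\<^sup>2 + (gIm x)\<^sup>2) * ((gRe y)\<^sup>2 + (gIm y)\<^sup>2)"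
    by (simp add: times_gauss_int_def power2_eq_square algebra_simps)
  moreover have "(gRe x)\<^sup>2 + (gIm x)\<^sup>2 \<noteq> 0" "(gRe y)\<^sup>2 + (gIm y)\<^sup>2 \<noteq> 0"
    using x y by (auto simp: gauss_int_eq_iff zero_gauss_int_def sum_power2_eq_zero_iff)
  ultimately show "x * y \<noteq> 0"
    by (auto simp: zero_gauss_int_def)
qed (auto simp: gauss_int_eq_iff gauss_int_ops algebra_simps)

end

definition gauss_i :: gauss_int where
  "gauss_i = Gauss_Int 0 1"

definition complex_of_gauss :: "gauss_int \<Rightarrow> complex" where
  "complex_of_gauss z = Complex (of_int (gRe z)) (of_int (gIm z))"

definition gauss_norm :: "gauss_int \<Rightarrow> int" where
  "gauss_norm z = (gRe z)\<^sup>2 + (gIm z)\<^sup>2"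

definition gauss_odd :: "gauss_int \<Rightarrow> bool" where
  "gauss_odd z \<longleftrightarrow> odd (gRe z - gIm z)"

definition Gamma_quadrant :: "gauss_int set" where
  "Gamma_quadrant = {z. gRe z > 0 \<and> gIm z \<ge> 0}"

definition Gauss_Rats :: "complex set" where
  "Gauss_Rats = {z. Re z \<in> \<rat> \<and> Im z \<in> \<rat>}"


section \<open>Mixed graphs\<close>

text \<open>
  \<open>edges\<close> is the edge set of the underlying simple graph; \<open>arcs\<close> chooses a direction for
  the edges that are oriented.  The vertex set \<open>[n]\<close> is rendered as \<open>{..<n}\<close>, in accordance
  with the 0-based matrix indices.
\<close>

record mixed_graph =
  edges :: "nat set set"
  arcs :: "(nat \<times> nat) set"

definition mixed_graphs :: "nat \<Rightarrow> mixed_graph set" where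
  "mixed_graphs n = {G.
     edges G \<subseteq> {{u, v} | u v. u < n \<and> v < n \<and> u \<noteq> v} \<and>
     (\<forall>u v. (u, v) \<in> arcs G \<longrightarrow> {u, v} \<in> edges G \<and> (v, u) \<notin> arcs G)}"

definition mg_converse :: "mixed_graph \<Rightarrow> mixed_graph" where
  "mg_converse G = G\<lparr>arcs := (arcs G)\<inverse>\<rparr>"

definition mg_isomorphic :: "nat \<Rightarrow> mixed_graph \<Rightarrow> mixed_graph \<Rightarrow> bool" where
  "mg_isomorphic n G H \<longleftrightarrow> (\<exists>f. bij_betw f {..<n} {..<n} \<and>
     (\<forall>u<n. \<forall>v<n. ({u, v} \<in> edges G \<longleftrightarrow> {f u, f v} \<in> edges H) \<and>
                   ((u, v) \<in> arcs G \<longleftrightarrow> (f u, f v) \<in> arcs H)))"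

definition self_converse_graphs :: "nat \<Rightarrow> mixed_graph set" where
  "self_converse_graphs n = {G \<in> mixed_graphs n. mg_isomorphic n G (mg_converse G)}"

definition herm_adj_mat :: "nat \<Rightarrow> mixed_graph \<Rightarrow> gauss_int mat" where
  "herm_adj_mat n G = mat n n (\<lambda>(u, v).
     if (u, v) \<in> arcs G then gauss_i
     else if (v, u) \<in> arcs G then - gauss_i
     else if {u, v} \<in> edges G then 1
     else 0)"

definition ones_vec :: "nat \<Rightarrow> 'a :: one vec" where
  "ones_vec n = vec n (\<lambda>_. 1)"

definition walk_mat :: "nat \<Rightarrow> gauss_int mat \<Rightarrow> gauss_int mat" where
  "walk_mat n A = mat_of_cols n (map (\<lambda>k. (A ^\<^sub>m k) *\<^sub>v ones_vec n) [0..<n])"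


section \<open>Gaussian rational unitary matrices\<close>

definition gauss_integral_mat :: "complex mat \<Rightarrow> bool" where
  "gauss_integral_mat M \<longleftrightarrow> elements_mat M \<subseteq> range complex_of_gauss"

definition gauss_rat_unitary :: "nat \<Rightarrow> complex mat set" where
  "gauss_rat_unitary n = {U \<in> carrier_mat n n.
     elements_mat U \<subseteq> Gauss_Rats \<and>
     mat_adjoint U * U = 1\<^sub>m n \<and> U * mat_adjoint U = 1\<^sub>m n}"

definition level :: "complex mat \<Rightarrow> gauss_int" where
  "level U = (THE l. l \<in> Gamma_quadrant \<and>
     gauss_integral_mat (complex_of_gauss l \<cdot>\<^sub>m U) \<and>
     (\<forall>m \<in> Gamma_quadrant. gauss_integral_mat (complex_of_gauss m \<cdot>\<^sub>m U) \<longrightarrow>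
        gauss_norm l \<le> gauss_norm m))"

definition unitary_set :: "nat \<Rightarrow> mixed_graph \<Rightarrow> complex mat set" where
  "unitary_set n G = {U \<in> gauss_rat_unitary n.
     U *\<^sub>v ones_vec n = ones_vec n \<and>
     (\<exists>H \<in> self_converse_graphs n.
        mat_adjoint U * map_mat complex_of_gauss (herm_adj_mat n G) * U
          = map_mat complex_of_gauss (herm_adj_mat n H))}"

end

theory Submission
  imports Defs
begin

text \<open>
  Put \<open>M = \<ell> U\<close>, which is integral and, by minimality of \<open>\<ell>\<close>, nonzero modulo \<open>p\<close>. Writing \<open>B\<close> for
  the adjacency matrix of \<open>H\<close> and \<open>V\<close> for its walk matrix, \<open>A U = U B\<close> and \<open>U e = e\<close> give \<open>W = U V\<close>.
  The isomorphisms of \<open>G\<close> and \<open>H\<close> with their converses are permutation matrices \<open>P\<close>, \<open>R\<close>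
  conjugating \<open>A\<close>, \<open>B\<close> into their transposes. They express complex conjugation, which need not act
  modulo \<open>p\<close>, by permutations: with \<open>Y = P M\<close> one gets \<open>Y\<^sup>T W \<equiv> 0 (mod p)\<close> and, cancelling \<open>V\<close>,
  \<open>Y\<^sup>T M = \<ell>\<^sup>2 R\<^sup>T \<equiv> 0 (mod p\<^sup>2)\<close>.

  Suppose \<open>p\<^sup>2\<close> does not divide \<open>det W\<close>. Then both kernels of \<open>W\<close> modulo \<open>p\<close> are at most
  one-dimensional, so a column \<open>z\<close> of \<open>M\<close> that is nonzero modulo \<open>p\<close> is an eigenvector of \<open>A\<close>
  modulo \<open>p\<close>, and so is \<open>y = P z\<close> on the left: \<open>T z \<equiv> 0\<close> and \<open>y\<^sup>T T \<equiv> 0\<close> for some \<open>T = c A - \<mu>\<close>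
  with \<open>c\<close> nonzero modulo \<open>p\<close>. Since \<open>y\<^sup>T z \<equiv> 0\<close>, a multiple of \<open>z\<close> is congruent to \<open>v(A) e\<close> for a
  polynomial \<open>v\<close> of degree at most \<open>n - 2\<close>. The coefficient vector \<open>g\<close> of \<open>(c x - \<mu>) v\<close> then satisfies
  \<open>W g \<equiv> 0 (mod p)\<close> and \<open>y\<^sup>T W g \<equiv> 0 (mod p\<^sup>2)\<close>, which forces \<open>p\<^sup>2\<close> to divide \<open>det W\<close>.
\<close>

section \<open>Kernels of a matrix modulo a prime\<close>

lemma mat_mult_index_sum:
  assumes "A \<in> carrier_mat n m" "B \<in> carrier_mat m l" "i < n" "j < l"
  shows "(A * B) $$ (i, j) = (\<Sum>k<m. A $$ (i, k) * B $$ (k, j))"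
  using assms by (auto simp: scalar_prod_def lessThan_atLeast0 intro!: sum.cong)

lemma mult_mat_vec_index_sum:
  assumes "A \<in> carrier_mat n m" "v \<in> carrier_vec m" "i < n"
  shows "(A *\<^sub>v v) $ i = (\<Sum>k<m. A $$ (i, k) * v $ k)"
  using assms by (auto simp: scalar_prod_def lessThan_atLeast0 intro!: sum.cong)

lemma adj_mat_mult_index:
  fixes W :: "'a :: comm_ring_1 mat"
  assumes W: "W \<in> carrier_mat n n" and ij: "i < n" "j < n"
  shows "(\<Sum>k<n. adj_mat W $$ (i, k) * W $$ (k, j)) = (if i = j then det W else 0)"
    and "(\<Sum>k<n. W $$ (i, k) * adj_mat W $$ (k, j)) = (if i = j then det W else 0)"
  using mat_mult_index_sum[OF adj_mat(1)[OF W] W ij] mat_mult_index_sum[OF W adj_mat(1)[OF W] ij]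
  by (auto simp: adj_mat[OF W] ij split: if_splits)

lemma prime_square_dvd_mult_left:
  fixes p :: "'a :: idom"
  assumes p: "prime_elem p" and a: "\<not> p dvd a" and ab: "p\<^sup>2 dvd a * b"
  shows "p\<^sup>2 dvd b"
proof -
  have p0: "p \<noteq> 0"
    using p by auto
  have "p dvd a * b"
    using ab by (auto simp: power2_eq_square dest: dvd_mult_left)
  with p a obtain c where b: "b = p * c"
    by (auto simp: prime_elem_dvd_mult_iff)
  with ab p0 have "p dvd a * c"
    by (simp add: power2_eq_square mult.left_commute[of a])
  with p a b show ?thesis
    by (auto simp: prime_elem_dvd_mult_iff power2_eq_square)
qed

section \<open>Replacing a row in order to divide out a prime\<close>

definition replace_row :: "'a mat \<Rightarrow> nat \<Rightarrow> (nat \<Rightarrow> 'a) \<Rightarrow> 'a mat" where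
  "replace_row W a u = mat (dim_row W) (dim_col W) (\<lambda>(i, j). if i = a then u j else W $$ (i, j))"

lemma det_replace_row:
  fixes W :: "'a :: comm_ring_1 mat"
  assumes W: "W \<in> carrier_mat n n" and a: "a < n"
  shows "det (replace_row W a u) = (\<Sum>j<n. u j * adj_mat W $$ (j, a))"
proof -
  let ?V = "replace_row W a u"
  have V: "?V \<in> carrier_mat n n"
    using W by (auto simp: replace_row_def)
  have "mat_delete ?V a j = mat_delete W a j" for j
    using W a by (intro eq_matI) (auto simp: mat_delete_def replace_row_def)
  then have "cofactor ?V a j = cofactor W a j" for j
    by (simp add: cofactor_def)
  then show ?thesis
    using W a by (subst laplace_expansion_row[OF V a])
      (auto simp: replace_row_def adj_mat_def intro!: sum.cong)
qed

text \<open>Multiplying \<open>W q\<close> by the adjugate gives \<open>det W\<close> times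
  \<open>q\<close>; the entry at \<open>b\<close> decides.\<close>

lemma prime_dvd_det_right_kernel:
  fixes W :: "'a :: idom mat"
  assumes W: "W \<in> carrier_mat n n" and p: "prime_elem p"
    and ker: "\<And>i. i < n \<Longrightarrow> p dvd (\<Sum>j<n. W $$ (i, j) * q j)"
    and b: "b < n" "\<not> p dvd q b"
  shows "p dvd det W"
proof -
  have "(\<Sum>i<n. adj_mat W $$ (b, i) * (\<Sum>j<n. W $$ (i, j) * q j))
      = (\<Sum>j<n. (\<Sum>i<n. adj_mat W $$ (b, i) * W $$ (i, j)) * q j)"
    by (simp add: sum_distrib_left sum_distrib_right mult.assoc) (rule sum.swap)
  also have "\<dots> = det W * q b"
    using b by (simp add: adj_mat_mult_index[OF W] if_distrib[of "\<lambda>x. x * _"] cong: if_cong)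
  finally have "p dvd det W * q b"
    using ker by (metis (no_types, lifting) dvd_mult dvd_sum lessThan_iff)
  with b p show ?thesis
    by (simp add: prime_elem_dvd_mult_iff)
qed

lemma prime_dvd_det_left_kernel:
  fixes W :: "'a :: idom mat"
  assumes W: "W \<in> carrier_mat n n" and p: "prime_elem p"
    and ker: "\<And>j. j < n \<Longrightarrow> p dvd (\<Sum>i<n. y i * W $$ (i, j))"
    and a: "a < n" "\<not> p dvd y a"
  shows "p dvd det W"
proof -
  have "p dvd det W\<^sup>T"
    using W ker a by (intro prime_dvd_det_right_kernel[OF _ p, of _ n y a]) (auto simp: mult.commute)
  then show ?thesis
    using det_transpose[OF W] by simp
qed

text \<open>If the row vector \<open>y\<close> satisfies \<open>y W = p u\<close>, replacing row \<open>a\<close> of \<open>W\<close> by \<open>u\<close> divides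
  out one factor \<open>p\<close> of \<open>y a * det W\<close>; a second kernel vector then yields another one.\<close>

lemma det_divide_row:
  fixes W :: "'a :: idom mat"
  assumes W: "W \<in> carrier_mat n n"
    and u: "\<And>j. j < n \<Longrightarrow> (\<Sum>i<n. y i * W $$ (i, j)) = p * u j"
    and a: "a < n"
  shows "y a * det W = p * det (replace_row W a u)"
proof -
  have "p * det (replace_row W a u) = (\<Sum>j<n. (\<Sum>i<n. y i * W $$ (i, j)) * adj_mat W $$ (j, a))"
    using u by (simp add: det_replace_row[OF W a] sum_distrib_left mult.assoc)
  also have "\<dots> = (\<Sum>i<n. y i * (\<Sum>j<n. W $$ (i, j) * adj_mat W $$ (j, a)))"
    by (simp add: sum_distrib_left sum_distrib_right mult.assoc) (rule sum.swap)
  also have "\<dots> = y a * det W"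
    using a by (simp add: adj_mat_mult_index[OF W] if_distrib[of "\<lambda>x. _ * x"] cong: if_cong)
  finally show ?thesis ..
qed

text \<open>Two independent left kernel vectors would put \<open>p^2\<close> into
  \<open>det W\<close>: the combination \<open>w\<close> vanishes at \<open>a\<close>, so it still
  annihilates the matrix modulo \<open>p\<close> after row \<open>a\<close> is replaced by
  \<open>u\<close>, and \<open>p\<close> times the new determinant is
  \<open>y a * det W\<close>.\<close>

lemma left_kernel_proportional:
  fixes W :: "'a :: idom mat"
  assumes W: "W \<in> carrier_mat n n" and p: "prime_elem p" and np: "\<not> p\<^sup>2 dvd det W"
    and y: "\<And>j. j < n \<Longrightarrow> p dvd (\<Sum>i<n. y i * W $$ (i, j))"
    and x: "\<And>j. j < n \<Longrightarrow> p dvd (\<Sum>i<n. x i * W $$ (i, j))"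
    and a: "a < n" "\<not> p dvd y a" and b: "b < n"
  shows "p dvd y a * x b - x a * y b"
proof (rule ccontr)
  assume nd: "\<not> ?thesis"
  from y obtain u where u: "\<And>j. j < n \<Longrightarrow> (\<Sum>i<n. y i * W $$ (i, j)) = p * u j"
    unfolding dvd_def by metis
  let ?V = "replace_row W a u"
  define w where "w i = y a * x i - x a * y i" for i
  have V: "?V \<in> carrier_mat n n"
    using W by (auto simp: replace_row_def)
  have "p dvd (\<Sum>i<n. w i * ?V $$ (i, j))" if j: "j < n" for j
  proof -
    have "w a = 0"
      by (simp add: w_def)
    then have "(\<Sum>i<n. w i * ?V $$ (i, j)) = (\<Sum>i<n. w i * W $$ (i, j))"
      using W j by (intro sum.cong) (auto simp: replace_row_def)
    also have "\<dots> = y a * (\<Sum>i<n. x i * W $$ (i, j)) - x a * (\<Sum>i<n. y i * W $$ (i, j))"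
      by (simp add: w_def sum_distrib_left sum_subtractf algebra_simps)
    finally show ?thesis
      using x[OF j] y[OF j] by simp
  qed
  then have "p dvd det ?V"
    using nd b by (intro prime_dvd_det_left_kernel[OF V p, of w b]) (auto simp: w_def)
  then have "p\<^sup>2 dvd y a * det W"
    using det_divide_row[OF W u a(1)] by (simp add: power2_eq_square)
  with a p np show False
    using prime_square_dvd_mult_left by blast
qed

text \<open>The hypothesis on \<open>p^2\<close> says that the new row \<open>u\<close>, with
  \<open>y^T W = p u\<close>, is orthogonal to \<open>q\<close> modulo \<open>p\<close>. Hence
  \<open>q\<close> stays in the kernel after the replacement, which gives \<open>y a * det W\<close>
  its second factor \<open>p\<close>.\<close>

lemma prime_square_dvd_det:
  fixes W :: "'a :: idom mat"
  assumes W: "W \<in> carrier_mat n n" and p: "prime_elem p"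
    and y: "\<And>j. j < n \<Longrightarrow> p dvd (\<Sum>i<n. y i * W $$ (i, j))"
    and q: "\<And>i. i < n \<Longrightarrow> p dvd (\<Sum>j<n. W $$ (i, j) * q j)"
    and yq: "p\<^sup>2 dvd (\<Sum>i<n. y i * (\<Sum>j<n. W $$ (i, j) * q j))"
    and a: "a < n" "\<not> p dvd y a" and b: "b < n" "\<not> p dvd q b"
  shows "p\<^sup>2 dvd det W"
proof -
  from y obtain u where u: "\<And>j. j < n \<Longrightarrow> (\<Sum>i<n. y i * W $$ (i, j)) = p * u j"
    unfolding dvd_def by metis
  let ?V = "replace_row W a u"
  have p0: "p \<noteq> 0"
    using p by auto
  have V: "?V \<in> carrier_mat n n"
    using W by (auto simp: replace_row_def)
  have "(\<Sum>i<n. y i * (\<Sum>j<n. W $$ (i, j) * q j)) = (\<Sum>j<n. (\<Sum>i<n. y i * W $$ (i, j)) * q j)"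
    by (simp add: sum_distrib_left sum_distrib_right mult.assoc) (rule sum.swap)
  also have "\<dots> = p * (\<Sum>j<n. u j * q j)"
    using u by (simp add: sum_distrib_left mult.assoc)
  finally have uq: "p dvd (\<Sum>j<n. u j * q j)"
    using yq p0 by (simp add: power2_eq_square)
  have "p dvd (\<Sum>j<n. ?V $$ (i, j) * q j)" if i: "i < n" for i
  proof (cases "i = a")
    case True
    then show ?thesis
      using uq W i by (simp add: replace_row_def)
  next
    case False
    then show ?thesis
      using q[OF i] W i by (simp add: replace_row_def)
  qed
  then have "p dvd det ?V"
    using b by (intro prime_dvd_det_right_kernel[OF V p, of q b]) auto
  then have "p\<^sup>2 dvd y a * det W"
    using det_divide_row[OF W u a(1)] by (simp add: power2_eq_square)
  with a p show ?thesis
    using prime_square_dvd_mult_left by blast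
qed

section \<open>Krylov matrices\<close>

lemma obtain_last_nondivisible:
  fixes x :: "nat \<Rightarrow> 'a :: comm_semiring_1"
  assumes "b < n" "\<not> p dvd x b"
  obtains m where "m < n" "\<not> p dvd x m" "\<And>k. m < k \<Longrightarrow> k < n \<Longrightarrow> p dvd x k"
proof -
  let ?S = "{m. m < n \<and> \<not> p dvd x m}"
  have fin: "finite ?S" and ne: "?S \<noteq> {}"
    using assms by auto
  show ?thesis
    using Max_in[OF fin ne] Max_ge[OF fin] by (intro that[of "Max ?S"]) (auto simp: not_le[symmetric])
qed

text \<open>Vectors are read as coefficient lists of polynomials; this is multiplication by the
  indeterminate.\<close>

definition shift_coeffs :: "(nat \<Rightarrow> 'a :: zero) \<Rightarrow> nat \<Rightarrow> 'a" where
  "shift_coeffs x i = (case i of 0 \<Rightarrow> 0 | Suc k \<Rightarrow> x k)"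

text \<open>Column \<open>k\<close> is \<open>A^k w\<close>, where the first column \<open>w\<close>
  is left free.\<close>

definition krylov_mat :: "nat \<Rightarrow> (nat \<Rightarrow> nat \<Rightarrow> 'a :: comm_semiring_1) \<Rightarrow> 'a mat \<Rightarrow> bool" where
  "krylov_mat n A W \<longleftrightarrow> W \<in> carrier_mat n n \<and>
     (\<forall>i k. i < n \<longrightarrow> Suc k < n \<longrightarrow> W $$ (i, Suc k) = (\<Sum>v<n. A i v * W $$ (v, k)))"

text \<open>With \<open>W x\<close> read as the polynomial \<open>x\<close> in \<open>A\<close>
  applied to the first column, a shift is an application of \<open>A\<close>. The coefficient at
  \<open>n - 1\<close> would move to degree \<open>n\<close>, outside the matrix, so its
  contribution is removed first.\<close>

lemma krylov_mat_shift:
  fixes A :: "nat \<Rightarrow> nat \<Rightarrow> 'a :: comm_ring_1"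
  assumes W: "krylov_mat n A W" and i: "i < n"
  shows "(\<Sum>j<n. W $$ (i, j) * shift_coeffs x j)
    = (\<Sum>v<n. A i v * ((\<Sum>j<n. W $$ (v, j) * x j) - W $$ (v, n - 1) * x (n - 1)))"
proof -
  obtain m where n: "n = Suc m"
    using i by (cases n) auto
  have "(\<Sum>j<n. W $$ (i, j) * shift_coeffs x j) = (\<Sum>j<m. W $$ (i, Suc j) * x j)"
    unfolding n by (subst sum.lessThan_Suc_shift) (simp add: shift_coeffs_def)
  also have "\<dots> = (\<Sum>j<m. (\<Sum>v<n. A i v * W $$ (v, j)) * x j)"
    using W i by (intro sum.cong) (auto simp: krylov_mat_def n)
  also have "\<dots> = (\<Sum>v<n. A i v * (\<Sum>j<m. W $$ (v, j) * x j))"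
    by (simp add: sum_distrib_left sum_distrib_right mult.assoc) (rule sum.swap)
  finally show ?thesis
    by (simp add: n)
qed

text \<open>Otherwise the shift of a kernel vector would be a second, independent kernel vector.\<close>

lemma krylov_kernel_top:
  fixes A :: "nat \<Rightarrow> nat \<Rightarrow> 'a :: idom"
  assumes W: "krylov_mat n A W" and p: "prime_elem p" and np: "\<not> p\<^sup>2 dvd det W"
    and q: "\<And>i. i < n \<Longrightarrow> p dvd (\<Sum>j<n. W $$ (i, j) * q j)"
    and b: "b < n" "\<not> p dvd q b"
  shows "\<not> p dvd q (n - 1)"
proof
  assume top: "p dvd q (n - 1)"
  have Wc: "W \<in> carrier_mat n n"
    using W by (simp add: krylov_mat_def)
  obtain m where m: "m < n" "\<not> p dvd q m" "\<And>k. m < k \<Longrightarrow> k < n \<Longrightarrow> p dvd q k"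
    using obtain_last_nondivisible[of b n p q] b by blast
  have "m \<noteq> n - 1"
    using top m(2) by auto
  then have Sm: "Suc m < n"
    using m(1) by auto
  have sh: "p dvd (\<Sum>j<n. W $$ (i, j) * shift_coeffs q j)" if "i < n" for i
    unfolding krylov_mat_shift[OF W that]
    by (rule dvd_sum, rule dvd_mult, rule dvd_diff) (use q top in auto)
  \<comment> \<open>Both \<open>q\<close> and its shift lie in the kernel, so their minor at
    \<open>m\<close> and \<open>Suc m\<close> is divisible by \<open>p\<close>; as
    \<open>q (Suc m)\<close> is divisible, \<open>q m * q m\<close> remains.\<close>
  have "p dvd q m * shift_coeffs q (Suc m) - shift_coeffs q m * q (Suc m)"
    using Wc q sh m Sm
    by (intro left_kernel_proportional[of "W\<^sup>T" n p q "shift_coeffs q" m "Suc m"])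
      (auto simp: p np det_transpose mult.commute)
  then have "p dvd q m * q m"
    using m(3)[OF _ Sm] by (simp add: shift_coeffs_def dvd_diff_left_iff)
  with m p show False
    by (simp add: prime_elem_dvd_mult_iff)
qed

text \<open>If the adjugate were \<open>p C\<close>, then \<open>C W = d' I\<close> with
  \<open>det W = p d'\<close>. Taking determinants, \<open>p\<close> divides a power of
  \<open>d'\<close>, hence \<open>d'\<close>, and \<open>p^2\<close> divides
  \<open>det W\<close>.\<close>

lemma adj_mat_not_divisible:
  fixes W :: "'a :: idom mat"
  assumes W: "W \<in> carrier_mat n n" and p: "prime_elem p"
    and d: "p dvd det W" and np: "\<not> p\<^sup>2 dvd det W"
  obtains i j where "i < n" "j < n" "\<not> p dvd adj_mat W $$ (i, j)"
proof -
  have "\<exists>i<n. \<exists>j<n. \<not> p dvd adj_mat W $$ (i, j)"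
  proof (rule ccontr)
    assume "\<not> ?thesis"
    then obtain c where c: "\<And>i j. i < n \<Longrightarrow> j < n \<Longrightarrow> adj_mat W $$ (i, j) = p * c i j"
      unfolding dvd_def by metis
    obtain d' where d': "det W = p * d'"
      using d by auto
    have p0: "p \<noteq> 0"
      using p by auto
    let ?C = "mat n n (\<lambda>(i, j). c i j)"
    have C: "?C \<in> carrier_mat n n"
      by simp
    have "?C * W = d' \<cdot>\<^sub>m 1\<^sub>m n"
    proof (rule eq_matI)
      fix i j assume "i < dim_row (d' \<cdot>\<^sub>m 1\<^sub>m n)" "j < dim_col (d' \<cdot>\<^sub>m 1\<^sub>m n)"
      then have ij: "i < n" "j < n"
        by auto
      have "p * (?C * W) $$ (i, j) = (\<Sum>k<n. adj_mat W $$ (i, k) * W $$ (k, j))"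
        using ij by (simp add: mat_mult_index_sum[OF C W ij] c sum_distrib_left mult.assoc)
      also have "\<dots> = p * (d' \<cdot>\<^sub>m 1\<^sub>m n) $$ (i, j)"
        using ij by (simp add: adj_mat_mult_index[OF W ij] d')
      finally show "(?C * W) $$ (i, j) = (d' \<cdot>\<^sub>m 1\<^sub>m n) $$ (i, j)"
        using p0 by simp
    qed (use W in auto)
    then have "det ?C * det W = d' ^ n"
      using det_mult[OF C W] by simp
    then have "p dvd d' ^ n"
      using d by (metis dvd_mult)
    then have "p dvd d'"
      using p prime_elem_dvd_power by blast
    with np d' show False
      by (simp add: power2_eq_square)
  qed
  with that show ?thesis
    by blast
qed

text \<open>Complex conjugation has been replaced by the permutation \<open>f\<close>, which turns
  \<open>A\<close> into its transpose, so the core argument runs over any integral domain.\<close>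

lemma krylov_prime_square_dvd_det:
  fixes A B M Y :: "nat \<Rightarrow> nat \<Rightarrow> 'a :: idom"
  assumes W: "krylov_mat n A W" and p: "prime_elem p"
    and f: "bij_betw f {..<n} {..<n}"
    and A: "\<And>u v. u < n \<Longrightarrow> v < n \<Longrightarrow> A (f u) (f v) = A v u"
    and Y: "\<And>u j. u < n \<Longrightarrow> j < n \<Longrightarrow> Y (f u) j = M u j"
    and AM: "\<And>i j. i < n \<Longrightarrow> j < n \<Longrightarrow> (\<Sum>k<n. A i k * M k j) = (\<Sum>k<n. M i k * B k j)"
    and YW: "\<And>j k. j < n \<Longrightarrow> k < n \<Longrightarrow> p dvd (\<Sum>i<n. Y i j * W $$ (i, k))"
    and YM: "\<And>i j. i < n \<Longrightarrow> j < n \<Longrightarrow> p\<^sup>2 dvd (\<Sum>w<n. Y w i * M w j)"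
    and nz: "b < n" "j < n" "\<not> p dvd M b j"
  shows "p\<^sup>2 dvd det W"
proof (rule ccontr)
  assume np: "\<not> ?thesis"
  have Wc: "W \<in> carrier_mat n n"
    using W by (simp add: krylov_mat_def)
  have p0: "p \<noteq> 0"
    using p by auto
  have fn: "f u < n" if "u < n" for u
    using f that by (auto simp: bij_betw_def)
  define a where "a = f b"
  \<comment> \<open>Modulo \<open>p\<close>, column \<open>k\<close> of \<open>M\<close> times
    \<open>c\<close> will be \<open>Y a k\<close> times column \<open>j\<close>. Substituted into
    \<open>A M = M B\<close> this gives \<open>c A z = \<mu> z\<close> modulo \<open>p\<close>,
    which dictates both constants.\<close>
  define c where "c = Y a j"
  define \<mu> where "\<mu> = (\<Sum>k<n. Y a k * B k j)"
  define y where "y i = Y i j" for i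
  define z where "z i = M i j" for i
  define T where "T x i = c * (\<Sum>v<n. A i v * x v) - \<mu> * x i" for x :: "nat \<Rightarrow> 'a" and i
  have a: "a < n" "\<not> p dvd y a" and c: "\<not> p dvd c"
    using nz by (auto simp: a_def c_def y_def fn Y)
  have zb: "\<not> p dvd z b"
    using nz by (simp add: z_def)
  have yW: "p dvd (\<Sum>i<n. y i * W $$ (i, k))" if "k < n" for k
    using YW that nz by (simp add: y_def)
  \<comment> \<open>All columns of \<open>Y\<close> lie in the one-dimensional left kernel of
    \<open>W\<close>, so \<open>M\<close> has rank one modulo \<open>p\<close>.\<close>
  have proportional: "p dvd c * M u k - Y a k * M u j" if "u < n" "k < n" for u k
  proof -
    have "p dvd y a * Y (f u) k - Y a k * y (f u)"
      by (rule left_kernel_proportional[OF Wc p np yW, of "\<lambda>i. Y i k"]) (use YW that a fn in auto)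
    then show ?thesis
      using that nz by (simp add: y_def c_def Y)
  qed

  have Tz: "p dvd T z u" if u: "u < n" for u
  proof -
    have "T z u = (\<Sum>k<n. (c * M u k - Y a k * M u j) * B k j)"
      using u nz by (simp add: T_def z_def AM \<mu>_def sum_distrib_left sum_distrib_right
          sum_subtractf algebra_simps)
    then show ?thesis
      using proportional[OF u] by (auto intro!: dvd_sum)
  qed
  \<comment> \<open>Since \<open>f\<close> transposes \<open>A\<close>, the row \<open>y^T T\<close>
    is \<open>T z\<close> with permuted entries; thus \<open>y\<close> is a left eigenvector modulo
    \<open>p\<close>.\<close>
  have sym: "(\<Sum>i<n. y i * T x i) = (\<Sum>w<n. T z w * x (f w))" for x
  proof -
    have "(\<Sum>i<n. y i * T x i) = (\<Sum>u<n. z u * T x (f u))"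
      using nz by (subst sum.reindex_bij_betw[OF f, symmetric]) (simp add: y_def z_def Y)
    also have "\<dots> = (\<Sum>u<n. z u * (c * (\<Sum>w<n. A w u * x (f w)) - \<mu> * x (f u)))"
    proof (rule sum.cong)
      fix u assume "u \<in> {..<n}"
      then have "(\<Sum>v<n. A (f u) v * x v) = (\<Sum>w<n. A w u * x (f w))"
        by (subst sum.reindex_bij_betw[OF f, symmetric]) (simp add: A)
      then show "z u * T x (f u) = z u * (c * (\<Sum>w<n. A w u * x (f w)) - \<mu> * x (f u))"
        by (simp add: T_def)
    qed simp
    also have "\<dots> = c * (\<Sum>u<n. \<Sum>w<n. A w u * z u * x (f w)) - \<mu> * (\<Sum>u<n. z u * x (f u))"
      by (simp add: sum_distrib_left sum_subtractf algebra_simps)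
    also have "\<dots> = (\<Sum>w<n. T z w * x (f w))"
      by (subst sum.swap) (simp add: T_def sum_distrib_left sum_distrib_right sum_subtractf algebra_simps)
    finally show ?thesis .
  qed
  \<comment> \<open>\<open>A M = M B\<close> turns \<open>y^T A z\<close> into a combination of
    entries of \<open>Y^T M\<close>, which are divisible by \<open>p^2\<close>.\<close>
  have yTz: "p\<^sup>2 dvd (\<Sum>i<n. y i * T z i)"
  proof -
    have "(\<Sum>i<n. y i * T z i)
      = c * (\<Sum>i<n. y i * (\<Sum>k<n. M i k * B k j)) - \<mu> * (\<Sum>i<n. y i * z i)"
      using nz by (simp add: T_def z_def AM sum_distrib_left sum_subtractf algebra_simps)
    moreover have "(\<Sum>i<n. y i * (\<Sum>k<n. M i k * B k j)) = (\<Sum>k<n. (\<Sum>i<n. y i * M i k) * B k j)"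
      by (simp add: sum_distrib_left sum_distrib_right mult.assoc) (rule sum.swap)
    moreover have "p\<^sup>2 dvd c * (\<Sum>k<n. (\<Sum>i<n. y i * M i k) * B k j) - \<mu> * (\<Sum>i<n. y i * z i)"
    proof -
      have "p\<^sup>2 dvd (\<Sum>i<n. y i * M i k)" if "k < n" for k
        using YM nz that by (simp add: y_def)
      then have "p\<^sup>2 dvd (\<Sum>k<n. (\<Sum>i<n. y i * M i k) * B k j)" "p\<^sup>2 dvd (\<Sum>i<n. y i * z i)"
        using nz by - (rule dvd_sum, rule dvd_mult2, simp_all add: z_def)
      then show ?thesis
        by simp
    qed
    ultimately show ?thesis
      by simp
  qed
  have "p dvd det W"
    by (rule prime_dvd_det_left_kernel[OF Wc p yW a])
  then obtain d' where d': "det W = p * d'"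
    by auto
  have nd': "\<not> p dvd d'"
    using np d' by (simp add: power2_eq_square)
  define C where "C = adj_mat W"
  obtain r s where rs: "r < n" "s < n" "\<not> p dvd C $$ (r, s)"
    using adj_mat_not_divisible[OF Wc p _ np] d' by (auto simp: C_def)
  \<comment> \<open>The product of \<open>W\<close> and \<open>C\<close> is \<open>det W\<close>
    times the identity, so every column of \<open>C\<close> is in the kernel modulo
    \<open>p\<close>; column \<open>s\<close> is a nonzero one.\<close>
  define q where "q k = C $$ (k, s)" for k
  have q: "p dvd (\<Sum>k<n. W $$ (i, k) * q k)" if "i < n" for i
    using that rs by (simp add: q_def C_def adj_mat_mult_index[OF Wc] d')
  define t where "t = q (n - 1)"
  have t: "\<not> p dvd t"
    unfolding t_def by (rule krylov_kernel_top[OF W p np q, of r]) (use rs in \<open>auto simp: q_def\<close>)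

  \<comment> \<open>The rows of \<open>C\<close> lie in the left kernel, hence are multiples of
    \<open>y\<close> modulo \<open>p\<close>, and \<open>y^T z\<close> vanishes modulo
    \<open>p\<close>. Divisibility of \<open>C z\<close> then puts \<open>d' z\<close> into the
    image of \<open>W\<close>.\<close>
  have "p dvd (\<Sum>u<n. C $$ (i, u) * z u)" if i: "i < n" for i
  proof -
    have "p dvd y a * C $$ (i, u) - C $$ (i, a) * y u" if "u < n" for u
      by (rule left_kernel_proportional[OF Wc p np yW, of "\<lambda>u. C $$ (i, u)"])
        (use i that a in \<open>auto simp: C_def adj_mat_mult_index[OF Wc] d'\<close>)
    then have "p dvd (\<Sum>u<n. (y a * C $$ (i, u) - C $$ (i, a) * y u) * z u)"
      by (auto intro!: dvd_sum)
    moreover have "(\<Sum>u<n. (y a * C $$ (i, u) - C $$ (i, a) * y u) * z u)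
        = y a * (\<Sum>u<n. C $$ (i, u) * z u) - C $$ (i, a) * (\<Sum>u<n. y u * z u)"
      by (simp add: sum_distrib_left sum_subtractf algebra_simps)
    moreover have "p dvd (\<Sum>u<n. y u * z u)"
      using YM[OF nz(2) nz(2)] by (auto simp: y_def z_def power2_eq_square dest: dvd_mult_left)
    ultimately have "p dvd y a * (\<Sum>u<n. C $$ (i, u) * z u)"
      by (simp add: dvd_diff_left_iff)
    with a p show ?thesis
      by (simp add: prime_elem_dvd_mult_iff)
  qed
  then obtain v where v: "\<And>i. i < n \<Longrightarrow> (\<Sum>u<n. C $$ (i, u) * z u) = p * v i"
    unfolding dvd_def by metis
  have Wv: "(\<Sum>k<n. W $$ (i, k) * v k) = d' * z i" if i: "i < n" for i
  proof -
    have "p * (\<Sum>k<n. W $$ (i, k) * v k) = (\<Sum>k<n. W $$ (i, k) * (\<Sum>u<n. C $$ (k, u) * z u))"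
      by (simp add: v sum_distrib_left mult.left_commute)
    also have "\<dots> = (\<Sum>u<n. (\<Sum>k<n. W $$ (i, k) * C $$ (k, u)) * z u)"
      by (simp add: sum_distrib_left sum_distrib_right mult.assoc) (rule sum.swap)
    also have "\<dots> = p * (d' * z i)"
      using i by (simp add: C_def adj_mat_mult_index[OF Wc] d' if_distrib[of "\<lambda>x. x * _"] cong: if_cong)
    finally show ?thesis
      using p0 by simp
  qed

  txt \<open>Subtracting a multiple of \<open>q\<close> removes the last coefficient of \<open>v\<close>, so that multiplication
    by the polynomial \<open>c x - \<mu>\<close> stays within degree \<open>n - 1\<close>.\<close>
  define v' where "v' k = t * v k - v (n - 1) * q k" for k
  define g where "g k = c * shift_coeffs v' k - \<mu> * v' k" for k
  have v'_top: "v' (n - 1) = 0"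
    by (simp add: v'_def t_def)
  obtain w where w: "\<And>i. i < n \<Longrightarrow> (\<Sum>k<n. W $$ (i, k) * q k) = p * w i"
    using q unfolding dvd_def by metis
  have Wv': "(\<Sum>k<n. W $$ (i, k) * v' k) = t * d' * z i - v (n - 1) * p * w i" if i: "i < n" for i
  proof -
    have "(\<Sum>k<n. W $$ (i, k) * v' k)
        = t * (\<Sum>k<n. W $$ (i, k) * v k) - v (n - 1) * (\<Sum>k<n. W $$ (i, k) * q k)"
      by (simp add: v'_def sum_distrib_left sum_subtractf algebra_simps)
    then show ?thesis
      by (simp add: Wv[OF i] w[OF i])
  qed
  \<comment> \<open>\<open>W g\<close> is \<open>T\<close> applied to \<open>W v'\<close>: the shift
    loses no term because \<open>v' (n - 1) = 0\<close>.\<close>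
  have Wg: "(\<Sum>k<n. W $$ (i, k) * g k) = t * d' * T z i - v (n - 1) * p * T w i" if i: "i < n" for i
  proof -
    have "(\<Sum>k<n. W $$ (i, k) * g k)
        = c * (\<Sum>k<n. W $$ (i, k) * shift_coeffs v' k) - \<mu> * (\<Sum>k<n. W $$ (i, k) * v' k)"
      by (simp add: g_def sum_distrib_left sum_subtractf algebra_simps)
    also have "(\<Sum>k<n. W $$ (i, k) * shift_coeffs v' k)
        = (\<Sum>u<n. A i u * (t * d' * z u - v (n - 1) * p * w u))"
      by (simp add: krylov_mat_shift[OF W i] v'_top[simplified] Wv')
    also have "\<dots> = t * d' * (\<Sum>u<n. A i u * z u) - v (n - 1) * p * (\<Sum>u<n. A i u * w u)"
      by (simp add: sum_distrib_left sum_subtractf algebra_simps)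
    also note Wv'[OF i]
    finally show ?thesis
      by (simp add: T_def algebra_simps)
  qed
  \<comment> \<open>Otherwise \<open>t d' z\<close> would vanish modulo \<open>p\<close>, though
    none of \<open>t\<close>, \<open>d'\<close> and \<open>z b\<close> is divisible.\<close>
  have "\<exists>m<n. \<not> p dvd v' m"
  proof (rule ccontr)
    assume "\<not> ?thesis"
    then have "p dvd (\<Sum>k<n. W $$ (b, k) * v' k)"
      by (auto intro!: dvd_sum)
    then have "p dvd t * d' * z b"
      using Wv'[OF nz(1)] by (simp add: dvd_diff_left_iff)
    with t nd' zb p show False
      by (simp add: prime_elem_dvd_mult_iff)
  qed
  then obtain m where m: "m < n" "\<not> p dvd v' m" "\<And>k. m < k \<Longrightarrow> k < n \<Longrightarrow> p dvd v' k"
    using obtain_last_nondivisible[of _ n p v'] by blast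
  have "m \<noteq> n - 1"
    using v'_top m(2) by auto
  then have Sm: "Suc m < n"
    using m(1) by auto
  \<comment> \<open>Modulo \<open>p\<close>, the leading coefficient of
    \<open>(c x - \<mu>) v'\<close> is \<open>c\<close> times that of \<open>v'\<close>.\<close>
  have "\<not> p dvd g (Suc m)"
  proof
    assume "p dvd g (Suc m)"
    then have "p dvd c * v' m"
      using m(3)[OF _ Sm] by (simp add: g_def shift_coeffs_def dvd_diff_left_iff)
    with c m p show False
      by (simp add: prime_elem_dvd_mult_iff)
  qed
  moreover have "p dvd (\<Sum>k<n. W $$ (i, k) * g k)" if "i < n" for i
    using Tz[OF that] by (simp add: Wg[OF that])
  \<comment> \<open>The \<open>z\<close> part is covered by \<open>yTz\<close>; the \<open>w\<close>
    part carries one explicit \<open>p\<close> and gets the other from \<open>y^T T\<close> through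
    \<open>sym\<close>.\<close>
  moreover have "p\<^sup>2 dvd (\<Sum>i<n. y i * (\<Sum>k<n. W $$ (i, k) * g k))"
  proof -
    have "(\<Sum>i<n. y i * (\<Sum>k<n. W $$ (i, k) * g k))
        = (\<Sum>i<n. y i * (t * d' * T z i - v (n - 1) * p * T w i))"
      by (simp add: Wg)
    also have "\<dots> = t * d' * (\<Sum>i<n. y i * T z i) - v (n - 1) * (p * (\<Sum>i<n. y i * T w i))"
      by (simp add: sum_distrib_left sum_subtractf algebra_simps)
    finally have "(\<Sum>i<n. y i * (\<Sum>k<n. W $$ (i, k) * g k))
        = t * d' * (\<Sum>i<n. y i * T z i) - v (n - 1) * (p * (\<Sum>i<n. y i * T w i))" .
    moreover have "p dvd (\<Sum>i<n. y i * T w i)"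
      unfolding sym using Tz by (auto intro!: dvd_sum)
    ultimately show ?thesis
      using yTz by (simp add: power2_eq_square dvd_diff mult_dvd_mono)
  qed
  ultimately have "p\<^sup>2 dvd det W"
    using prime_square_dvd_det[OF Wc p yW _ _ a Sm, of g] by blast
  with np show False
    by contradiction
qed

section \<open>Gaussian integers and the level\<close>

lemma gauss_int_sel [simp]:
  "gRe 0 = 0" "gIm 0 = 0" "gRe 1 = 1" "gIm 1 = 0"
  "gRe (x + y) = gRe x + gRe y" "gIm (x + y) = gIm x + gIm y"
  "gRe (- x) = - gRe x" "gIm (- x) = - gIm x"
  "gRe (x - y) = gRe x - gRe y" "gIm (x - y) = gIm x - gIm y"
  "gRe (x * y) = gRe x * gRe y - gIm x * gIm y"
  "gIm (x * y) = gRe x * gIm y + gIm x * gRe y"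
  "gRe gauss_i = 0" "gIm gauss_i = 1"
  by (simp_all add: gauss_int_ops gauss_i_def)

lemma Re_Im_complex_of_gauss [simp]:
  "Re (complex_of_gauss z) = of_int (gRe z)" "Im (complex_of_gauss z) = of_int (gIm z)"
  by (simp_all add: complex_of_gauss_def)

interpretation gauss_hom: inj_comm_ring_hom complex_of_gauss
  by unfold_locales (auto simp: complex_eq_iff gauss_int_eq_iff)

definition gauss_cnj :: "gauss_int \<Rightarrow> gauss_int" where
  "gauss_cnj z = Gauss_Int (gRe z) (- gIm z)"

lemma complex_of_gauss_cnj [simp]: "complex_of_gauss (gauss_cnj z) = cnj (complex_of_gauss z)"
  by (simp add: complex_eq_iff gauss_cnj_def)

section \<open>Norm, units and division in the Gaussian integers\<close>

lemma gauss_norm_cmod: "real_of_int (gauss_norm z) = (cmod (complex_of_gauss z))\<^sup>2"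
  by (simp add: gauss_norm_def cmod_power2)

lemma gauss_norm_mult: "gauss_norm (x * y) = gauss_norm x * gauss_norm y"
  by (simp add: gauss_norm_def power2_eq_square algebra_simps)

lemma gauss_norm_nonneg: "gauss_norm z \<ge> 0"
  by (simp add: gauss_norm_def)

lemma gauss_norm_eq_0_iff: "gauss_norm z = 0 \<longleftrightarrow> z = 0"
  by (auto simp: gauss_norm_def sum_power2_eq_zero_iff gauss_int_eq_iff)

lemma gauss_norm_eq_1_cases:
  assumes "gauss_norm c = 1"
  shows "c = 1 \<or> c = -1 \<or> c = gauss_i \<or> c = - gauss_i"
proof -
  have eq: "(gRe c)\<^sup>2 + (gIm c)\<^sup>2 = 1"
    using assms by (simp add: gauss_norm_def)
  have "(gRe c)\<^sup>2 \<le> 1"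
    using eq zero_le_power2[of "gIm c"] by linarith
  moreover have "(gIm c)\<^sup>2 \<le> 1"
    using eq zero_le_power2[of "gRe c"] by linarith
  ultimately have "\<bar>gRe c\<bar> \<le> 1" "\<bar>gIm c\<bar> \<le> 1"
    by (simp_all only: abs_square_le_1)
  then have "gRe c = -1 \<or> gRe c = 0 \<or> gRe c = 1" "gIm c = -1 \<or> gIm c = 0 \<or> gIm c = 1"
    by auto
  with eq show ?thesis
    by (auto simp: gauss_int_eq_iff)
qed

lemma gauss_unit_if_norm_1:
  assumes "gauss_norm c = 1"
  shows "c dvd 1"
proof -
  have "c * gauss_cnj c = 1"
    using assms by (simp add: gauss_int_eq_iff gauss_norm_def gauss_cnj_def power2_eq_square)
  then show ?thesis
    by (metis dvd_triv_left)
qed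

text \<open>Rounding both coordinates of the complex quotient leaves an error of squared modulus at
  most \<open>1/2\<close>.\<close>

lemma gauss_division:
  assumes "b \<noteq> 0"
  obtains q where "gauss_norm (a - q * b) < gauss_norm b"
proof -
  let ?w = "complex_of_gauss a / complex_of_gauss b"
  define q where "q = Gauss_Int (round (Re ?w)) (round (Im ?w))"
  have b: "complex_of_gauss b \<noteq> 0"
    using assms by simp
  have "\<bar>Re (?w - complex_of_gauss q)\<bar> \<le> 1/2" "\<bar>Im (?w - complex_of_gauss q)\<bar> \<le> 1/2"
    using of_int_round_abs_le[of "Re ?w"] of_int_round_abs_le[of "Im ?w"]
    by (simp_all add: q_def abs_minus_commute)
  then have "(Re (?w - complex_of_gauss q))\<^sup>2 \<le> (1/2)\<^sup>2" "(Im (?w - complex_of_gauss q))\<^sup>2 \<le> (1/2)\<^sup>2"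
    by (subst power2_le_iff_abs_le; simp)+
  then have small: "(cmod (?w - complex_of_gauss q))\<^sup>2 < 1"
    unfolding cmod_power2 by (simp add: power2_eq_square)
  have "complex_of_gauss (a - q * b) = (?w - complex_of_gauss q) * complex_of_gauss b"
    using b by (simp add: gauss_hom.hom_minus gauss_hom.hom_mult field_simps)
  then have "real_of_int (gauss_norm (a - q * b))
      = (cmod (?w - complex_of_gauss q))\<^sup>2 * (cmod (complex_of_gauss b))\<^sup>2"
    by (simp add: gauss_norm_cmod norm_mult power_mult_distrib)
  also have "\<dots> < 1 * (cmod (complex_of_gauss b))\<^sup>2"
    using small b by (intro mult_strict_right_mono) auto
  finally have "gauss_norm (a - q * b) < gauss_norm b"
    by (simp add: gauss_norm_cmod[symmetric])
  then show ?thesis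
    by (rule that)
qed

text \<open>Units act as rotations by quarter turns, and \<open>Gamma_quadrant\<close> is one of
  four half-open quadrants that partition the nonzero numbers.\<close>

lemma Gamma_quadrant_rotate:
  assumes "z \<noteq> 0"
  obtains c where "gauss_norm c = 1" "c * z \<in> Gamma_quadrant"
proof -
  have "gRe z > 0 \<and> gIm z \<ge> 0 \<or> gRe z < 0 \<and> gIm z \<le> 0 \<or> gRe z \<ge> 0 \<and> gIm z < 0 \<or> gRe z \<le> 0 \<and> gIm z > 0"
    using assms by (auto simp: gauss_int_eq_iff)
  then consider "1 * z \<in> Gamma_quadrant" | "- 1 * z \<in> Gamma_quadrant"
    | "gauss_i * z \<in> Gamma_quadrant" | "- gauss_i * z \<in> Gamma_quadrant"
    by (auto simp: Gamma_quadrant_def)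
  then show ?thesis
    by cases (rule that[rotated], assumption, simp add: gauss_norm_def)+
qed

lemma Gamma_quadrant_unit_unique:
  assumes "gauss_norm c = 1" "z \<in> Gamma_quadrant" "c * z \<in> Gamma_quadrant"
  shows "c = 1"
  using gauss_norm_eq_1_cases[OF assms(1)] assms(2,3) by (auto simp: Gamma_quadrant_def)

section \<open>The ideal of denominators of a Gaussian rational matrix\<close>

lemma gauss_integral_mat_smult_iff:
  "gauss_integral_mat (c \<cdot>\<^sub>m U) \<longleftrightarrow>
     (\<forall>i<dim_row U. \<forall>j<dim_col U. c * U $$ (i, j) \<in> range complex_of_gauss)"
  unfolding gauss_integral_mat_def elements_mat_def by (force simp: subset_iff)

lemma range_complex_of_gauss_closed:
  assumes "x \<in> range complex_of_gauss" "y \<in> range complex_of_gauss"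
  shows "x - y \<in> range complex_of_gauss" "x * y \<in> range complex_of_gauss"
  using assms by (auto simp: gauss_hom.hom_minus[symmetric] gauss_hom.hom_mult[symmetric])

lemma gauss_integral_mat_smult_mult:
  assumes "gauss_integral_mat (complex_of_gauss m \<cdot>\<^sub>m U)"
  shows "gauss_integral_mat (complex_of_gauss (c * m) \<cdot>\<^sub>m U)"
  using assms range_complex_of_gauss_closed(2)[OF rangeI[of complex_of_gauss c]]
  by (simp add: gauss_integral_mat_smult_iff gauss_hom.hom_mult mult.assoc)

lemma gauss_integral_mat_smult_diff:
  assumes "gauss_integral_mat (complex_of_gauss l \<cdot>\<^sub>m U)" "gauss_integral_mat (complex_of_gauss m \<cdot>\<^sub>m U)"
  shows "gauss_integral_mat (complex_of_gauss (l - m) \<cdot>\<^sub>m U)"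
  using assms range_complex_of_gauss_closed(1)
  by (simp add: gauss_integral_mat_smult_iff gauss_hom.hom_minus left_diff_distrib)

lemma Gauss_Rats_denominator:
  assumes "z \<in> Gauss_Rats"
  obtains d where "d \<noteq> 0" "complex_of_gauss d * z \<in> range complex_of_gauss"
proof -
  from assms have "Re z \<in> \<rat>" "Im z \<in> \<rat>"
    by (auto simp: Gauss_Rats_def)
  then obtain a b c d where *: "b > 0" "Re z = of_int a / of_int b" "d > 0" "Im z = of_int c / of_int d"
    by (metis Rats_cases')
  show ?thesis
  proof (rule that)
    show "Gauss_Int (b * d) 0 \<noteq> 0"
      using * by (simp add: gauss_int_eq_iff)
    have "complex_of_gauss (Gauss_Int (b * d) 0) * z = complex_of_gauss (Gauss_Int (a * d) (c * b))"
      using * by (simp add: complex_eq_iff)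
    then show "complex_of_gauss (Gauss_Int (b * d) 0) * z \<in> range complex_of_gauss"
      by simp
  qed
qed

lemma Gauss_Rats_common_denominator:
  assumes "finite S" "S \<subseteq> Gauss_Rats"
  shows "\<exists>d. d \<noteq> 0 \<and> (\<forall>z\<in>S. complex_of_gauss d * z \<in> range complex_of_gauss)"
  using assms
proof (induction S rule: finite_induct)
  case empty
  show ?case
    by (rule exI[of _ 1]) simp
next
  case (insert x S)
  then obtain d where d: "d \<noteq> 0" "\<And>z. z \<in> S \<Longrightarrow> complex_of_gauss d * z \<in> range complex_of_gauss"
    by auto
  obtain c where c: "c \<noteq> 0" "complex_of_gauss c * x \<in> range complex_of_gauss"
    using Gauss_Rats_denominator insert.prems by blast
  have "complex_of_gauss (c * d) * z \<in> range complex_of_gauss" if "z \<in> insert x S" for z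
  proof (cases "z = x")
    case True
    then have "complex_of_gauss (c * d) * z = complex_of_gauss d * (complex_of_gauss c * x)"
      by (simp add: gauss_hom.hom_mult)
    then show ?thesis
      using range_complex_of_gauss_closed(2)[OF rangeI c(2)] by simp
  next
    case False
    with that have "complex_of_gauss d * z \<in> range complex_of_gauss"
      using d by auto
    then show ?thesis
      using range_complex_of_gauss_closed(2)[OF rangeI] by (simp add: gauss_hom.hom_mult mult.assoc)
  qed
  with c d show ?case
    by (intro exI[of _ "c * d"]) auto
qed

text \<open>The property inside the definite description of \<open>level\<close>, named so that
  existence and uniqueness can be proved.\<close>

definition is_level :: "complex mat \<Rightarrow> gauss_int \<Rightarrow> bool" where
  "is_level U l \<longleftrightarrow> l \<in> Gamma_quadrant \<and> gauss_integral_mat (complex_of_gauss l \<cdot>\<^sub>m U) \<and>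
     (\<forall>m \<in> Gamma_quadrant. gauss_integral_mat (complex_of_gauss m \<cdot>\<^sub>m U) \<longrightarrow>
        gauss_norm l \<le> gauss_norm m)"

text \<open>Rotating \<open>m\<close> into the quadrant preserves its norm and the integrality, so
  minimality extends to all nonzero denominators.\<close>

lemma is_level_norm_le:
  assumes "is_level U l" "m \<noteq> 0" "gauss_integral_mat (complex_of_gauss m \<cdot>\<^sub>m U)"
  shows "gauss_norm l \<le> gauss_norm m"
proof -
  obtain c where c: "gauss_norm c = 1" "c * m \<in> Gamma_quadrant"
    using Gamma_quadrant_rotate[OF assms(2)] .
  then have "gauss_norm l \<le> gauss_norm (c * m)"
    using assms gauss_integral_mat_smult_mult unfolding is_level_def by blast
  with c show ?thesis
    by (simp add: gauss_norm_mult)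
qed

text \<open>The remainder of \<open>m\<close> by \<open>l\<close> is a denominator of smaller norm
  than \<open>l\<close>, hence zero: the level generates the ideal of denominators.\<close>

lemma is_level_dvd:
  assumes l: "is_level U l" and m: "gauss_integral_mat (complex_of_gauss m \<cdot>\<^sub>m U)"
  shows "l dvd m"
proof -
  have l0: "l \<noteq> 0"
    using l by (auto simp: is_level_def Gamma_quadrant_def)
  obtain q where q: "gauss_norm (m - q * l) < gauss_norm l"
    using gauss_division[OF l0] .
  have "gauss_integral_mat (complex_of_gauss (m - q * l) \<cdot>\<^sub>m U)"
    using l m by (intro gauss_integral_mat_smult_diff gauss_integral_mat_smult_mult)
      (simp_all add: is_level_def)
  then have "m - q * l = 0"
    using is_level_norm_le[OF l, of "m - q * l"] q by force
  then show ?thesis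
    by simp
qed

lemma is_level_unique:
  assumes "is_level U l" "is_level U m"
  shows "l = m"
proof -
  have "l dvd m"
    using assms by (intro is_level_dvd[of U]) (auto simp: is_level_def)
  then obtain c where c: "m = c * l"
    by (metis dvdE mult.commute)
  have "gauss_norm l = gauss_norm m"
    using assms unfolding is_level_def by (meson order_antisym)
  moreover have "gauss_norm l \<noteq> 0"
    using assms by (auto simp: gauss_norm_eq_0_iff is_level_def Gamma_quadrant_def)
  ultimately have "gauss_norm c = 1"
    by (simp add: c gauss_norm_mult)
  with assms c show ?thesis
    using Gamma_quadrant_unit_unique[of c l] by (simp add: is_level_def)
qed

lemma is_level_exists:
  assumes "elements_mat U \<subseteq> Gauss_Rats"
  shows "\<exists>l. is_level U l"
proof -
  let ?P = "\<lambda>m. m \<in> Gamma_quadrant \<and> gauss_integral_mat (complex_of_gauss m \<cdot>\<^sub>m U)"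
  have "finite (elements_mat U)"
    unfolding elements_mat_def by simp
  then obtain d where d: "d \<noteq> 0" "\<forall>z\<in>elements_mat U. complex_of_gauss d * z \<in> range complex_of_gauss"
    using Gauss_Rats_common_denominator assms by blast
  have "gauss_integral_mat (complex_of_gauss d \<cdot>\<^sub>m U)"
    using d(2) by (auto simp: gauss_integral_mat_smult_iff elements_mat_def)
  moreover obtain c where "c * d \<in> Gamma_quadrant"
    using Gamma_quadrant_rotate[OF d(1)] by blast
  ultimately have "?P (c * d)"
    using gauss_integral_mat_smult_mult by blast
  then obtain l where "?P l" "\<And>m. ?P m \<Longrightarrow> nat (gauss_norm l) \<le> nat (gauss_norm m)"
    using ex_has_least_nat[of ?P "c * d" "\<lambda>m. nat (gauss_norm m)"] by blast
  then show ?thesis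
    unfolding is_level_def using gauss_norm_nonneg nat_le_eq_zle by blast
qed

lemma is_level_level:
  assumes "elements_mat U \<subseteq> Gauss_Rats"
  shows "is_level U (level U)"
proof -
  have "level U = (THE l. is_level U l)"
    by (simp add: level_def is_level_def)
  moreover have "is_level U (THE l. is_level U l)"
    using is_level_exists[OF assms] is_level_unique by (metis theI')
  ultimately show ?thesis
    by simp
qed

text \<open>If \<open>p\<close> divided all entries of \<open>M\<close>, the level divided by
  \<open>p\<close> would already be a denominator, of smaller norm.\<close>

lemma level_not_divisible:
  assumes U: "elements_mat U \<subseteq> Gauss_Rats" and p: "prime_elem p" "p dvd level U"
    and M: "\<And>i j. i < dim_row U \<Longrightarrow> j < dim_col U \<Longrightarrow>
      complex_of_gauss (M i j) = complex_of_gauss (level U) * U $$ (i, j)"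
  obtains i j where "i < dim_row U" "j < dim_col U" "\<not> p dvd M i j"
proof -
  have lev: "is_level U (level U)"
    using is_level_level[OF U] .
  have p0: "p \<noteq> 0"
    using p by auto
  from p obtain l where l: "level U = p * l"
    by auto
  have l0: "l \<noteq> 0"
    using lev l by (auto simp: is_level_def Gamma_quadrant_def)
  have "\<exists>i<dim_row U. \<exists>j<dim_col U. \<not> p dvd M i j"
  proof (rule ccontr)
    assume nd: "\<not> ?thesis"
    have "complex_of_gauss l * U $$ (i, j) \<in> range complex_of_gauss"
      if ij: "i < dim_row U" "j < dim_col U" for i j
    proof -
      obtain c where "M i j = p * c"
        using nd ij by (meson dvdE)
      then have "complex_of_gauss p * complex_of_gauss c
          = complex_of_gauss p * (complex_of_gauss l * U $$ (i, j))"
        using M[OF ij] l by (simp add: gauss_hom.hom_mult mult.assoc)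
      then have "complex_of_gauss l * U $$ (i, j) = complex_of_gauss c"
        using p0 by simp
      then show ?thesis
        by simp
    qed
    then have "gauss_norm (p * l) \<le> gauss_norm l"
      using is_level_norm_le[OF lev l0] l by (simp add: gauss_integral_mat_smult_iff)
    moreover have "gauss_norm l > 0"
      using gauss_norm_nonneg[of l] gauss_norm_eq_0_iff[of l] l0 by linarith
    ultimately have "gauss_norm p \<le> 1"
      by (simp add: gauss_norm_mult)
    then have "gauss_norm p = 1"
      using gauss_norm_nonneg[of p] gauss_norm_eq_0_iff[of p] p0 by linarith
    then show False
      using gauss_unit_if_norm_1 p(1) by (auto simp: prime_elem_def)
  qed
  with that show ?thesis
    by blast
qed

section \<open>Walk matrices of self-converse mixed graphs\<close>

lemma walk_mat_carrier: "walk_mat n A \<in> carrier_mat n n"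
  using mat_of_cols_carrier(1)[of n "map (\<lambda>k. (A ^\<^sub>m k) *\<^sub>v ones_vec n) [0..<n]"]
  by (simp add: walk_mat_def)

lemma walk_mat_index:
  assumes "i < n" "k < n"
  shows "walk_mat n A $$ (i, k) = ((A ^\<^sub>m k) *\<^sub>v ones_vec n) $ i"
  using assms by (simp add: walk_mat_def mat_of_cols_index)

lemma walk_mat_0:
  assumes "A \<in> carrier_mat n n" "i < n"
  shows "walk_mat n A $$ (i, 0) = 1"
  using assms by (simp add: walk_mat_index ones_vec_def)

text \<open>\<open>pow_mat\<close> appends the new factor on the right, whereas the Krylov recursion
  needs it on the left.\<close>

lemma pow_mat_Suc_mult_vec:
  assumes A: "(A :: 'a :: comm_ring_1 mat) \<in> carrier_mat n n" and v: "v \<in> carrier_vec n"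
  shows "(A ^\<^sub>m Suc k) *\<^sub>v v = A *\<^sub>v ((A ^\<^sub>m k) *\<^sub>v v)"
  using v
proof (induction k arbitrary: v)
  case 0
  then show ?case
    using A by simp
next
  case (Suc k)
  have Av: "A *\<^sub>v v \<in> carrier_vec n"
    using A Suc.prems by simp
  have step: "(A ^\<^sub>m Suc m) *\<^sub>v v = (A ^\<^sub>m m) *\<^sub>v (A *\<^sub>v v)" for m
    using A Suc.prems by (simp add: assoc_mult_mat_vec[of _ n n _ n])
  show ?case
    using Suc.IH[OF Av] by (simp only: step)
qed

lemma walk_mat_krylov:
  assumes A: "A \<in> carrier_mat n n"
  shows "krylov_mat n (\<lambda>i j. A $$ (i, j)) (walk_mat n A)"
proof -
  have e: "ones_vec n \<in> carrier_vec n"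
    by (simp add: ones_vec_def)
  have Ake: "(A ^\<^sub>m k) *\<^sub>v ones_vec n \<in> carrier_vec n" for k
    using A e by (intro mult_mat_vec_carrier[of _ n n]) auto
  show ?thesis
    unfolding krylov_mat_def
    by (auto simp: walk_mat_carrier walk_mat_index pow_mat_Suc_mult_vec[OF A e]
        mult_mat_vec_index_sum[OF A Ake] simp del: pow_mat.simps)
qed

section \<open>Complex conjugation as a permutation of the vertices\<close>

lemma herm_adj_mat_carrier: "herm_adj_mat n G \<in> carrier_mat n n"
  by (simp add: herm_adj_mat_def)

lemma herm_adj_mat_cnj:
  assumes "G \<in> mixed_graphs n" "u < n" "v < n"
  shows "gauss_cnj (herm_adj_mat n G $$ (u, v)) = herm_adj_mat n G $$ (v, u)"
  using assms by (auto simp: herm_adj_mat_def gauss_cnj_def gauss_int_eq_iff mixed_graphs_def insert_commute)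

text \<open>An isomorphism onto the converse reverses all arcs and so transposes the matrix; for a
  Hermitian matrix this is entrywise conjugation.\<close>

lemma self_converse_perm:
  assumes "G \<in> self_converse_graphs n"
  obtains f where "bij_betw f {..<n} {..<n}"
    "\<And>u v. u < n \<Longrightarrow> v < n \<Longrightarrow>
       herm_adj_mat n G $$ (f u, f v) = gauss_cnj (herm_adj_mat n G $$ (u, v))"
proof -
  from assms have G: "G \<in> mixed_graphs n"
    by (simp add: self_converse_graphs_def)
  from assms obtain f where f: "bij_betw f {..<n} {..<n}"
    and iso: "\<And>u v. u < n \<Longrightarrow> v < n \<Longrightarrow> ({u, v} \<in> edges G \<longleftrightarrow> {f u, f v} \<in> edges G) \<and>
      ((u, v) \<in> arcs G \<longleftrightarrow> (f v, f u) \<in> arcs G)"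
    by (auto simp: self_converse_graphs_def mg_isomorphic_def mg_converse_def)
  show ?thesis
  proof (rule that[OF f])
    fix u v assume uv: "u < n" "v < n"
    then have "f u < n" "f v < n"
      using f by (auto simp: bij_betw_def)
    then have "herm_adj_mat n G $$ (f u, f v) = herm_adj_mat n G $$ (v, u)"
      using uv iso[of u v] iso[of v u] by (auto simp: herm_adj_mat_def insert_commute)
    then show "herm_adj_mat n G $$ (f u, f v) = gauss_cnj (herm_adj_mat n G $$ (u, v))"
      using herm_adj_mat_cnj[OF G uv] by simp
  qed
qed

text \<open>The permutation conjugates \<open>A\<close> and fixes the all-one vector
  \<open>e\<close>, hence it conjugates every \<open>A^k e\<close>.\<close>

lemma walk_mat_cnj:
  assumes A: "A \<in> carrier_mat n n" and f: "bij_betw f {..<n} {..<n}"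
    and Af: "\<And>u v. u < n \<Longrightarrow> v < n \<Longrightarrow> A $$ (f u, f v) = gauss_cnj (A $$ (u, v))"
    and "u < n" "k < n"
  shows "complex_of_gauss (walk_mat n A $$ (f u, k)) = cnj (complex_of_gauss (walk_mat n A $$ (u, k)))"
  using \<open>u < n\<close> \<open>k < n\<close>
proof (induction k arbitrary: u)
  case 0
  moreover have "f u < n"
    using f 0 by (auto simp: bij_betw_def)
  ultimately show ?case
    by (simp add: walk_mat_0[OF A])
next
  case (Suc k)
  let ?W = "walk_mat n A"
  have step: "?W $$ (i, Suc k) = (\<Sum>v<n. A $$ (i, v) * ?W $$ (v, k))" if "i < n" for i
    using walk_mat_krylov[OF A] that Suc.prems by (simp add: krylov_mat_def)
  have fu: "f u < n"
    using f Suc.prems by (auto simp: bij_betw_def)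
  have "complex_of_gauss (?W $$ (f u, Suc k))
      = (\<Sum>v<n. complex_of_gauss (A $$ (f u, f v)) * complex_of_gauss (?W $$ (f v, k)))"
    unfolding step[OF fu]
    by (subst sum.reindex_bij_betw[OF f, symmetric]) (simp add: gauss_hom.hom_sum gauss_hom.hom_mult)
  also have "\<dots> = cnj (complex_of_gauss (?W $$ (u, Suc k)))"
    using Suc Af by (simp add: step gauss_hom.hom_sum gauss_hom.hom_mult)
  finally show ?case .
qed

section \<open>Walk matrices related by a unitary matrix\<close>

lemma mat_adjoint_index:
  assumes "U \<in> carrier_mat n m" "i < m" "j < n"
  shows "mat_adjoint U $$ (i, j) = conjugate (U $$ (j, i))"
  using assms by (simp add: mat_adjoint_def mat_of_rows_index)

lemma mat_adjoint_carrier: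
  assumes "U \<in> carrier_mat n m"
  shows "mat_adjoint U \<in> carrier_mat m n"
  using assms by (auto simp: mat_adjoint_def)

text \<open>From \<open>A U = U B\<close> and \<open>U e = e\<close> follows
  \<open>A^k e = A^k U e = U B^k e\<close>.\<close>

lemma unitary_walk_mat:
  fixes U :: "complex mat"
  assumes A: "A \<in> carrier_mat n n" and B: "B \<in> carrier_mat n n"
    and Ue: "\<And>i. i < n \<Longrightarrow> (\<Sum>k<n. U $$ (i, k)) = 1"
    and AU: "\<And>i j. i < n \<Longrightarrow> j < n \<Longrightarrow>
      (\<Sum>k<n. complex_of_gauss (A $$ (i, k)) * U $$ (k, j))
        = (\<Sum>k<n. U $$ (i, k) * complex_of_gauss (B $$ (k, j)))"
    and "i < n" "k < n"
  shows "complex_of_gauss (walk_mat n A $$ (i, k))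
    = (\<Sum>v<n. U $$ (i, v) * complex_of_gauss (walk_mat n B $$ (v, k)))"
  using \<open>i < n\<close> \<open>k < n\<close>
proof (induction k arbitrary: i)
  case 0
  then show ?case
    by (simp add: walk_mat_0[OF A] walk_mat_0[OF B] Ue)
next
  case (Suc k)
  let ?c = complex_of_gauss and ?W = "walk_mat n A" and ?V = "walk_mat n B"
  have stepA: "?W $$ (i, Suc k) = (\<Sum>v<n. A $$ (i, v) * ?W $$ (v, k))" if "i < n" for i
    using walk_mat_krylov[OF A] that Suc.prems by (simp add: krylov_mat_def)
  have stepB: "?V $$ (i, Suc k) = (\<Sum>v<n. B $$ (i, v) * ?V $$ (v, k))" if "i < n" for i
    using walk_mat_krylov[OF B] that Suc.prems by (simp add: krylov_mat_def)
  have "?c (?W $$ (i, Suc k)) = (\<Sum>v<n. ?c (A $$ (i, v)) * (\<Sum>w<n. U $$ (v, w) * ?c (?V $$ (w, k))))"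
    using Suc by (simp add: stepA gauss_hom.hom_sum gauss_hom.hom_mult)
  also have "\<dots> = (\<Sum>w<n. (\<Sum>v<n. ?c (A $$ (i, v)) * U $$ (v, w)) * ?c (?V $$ (w, k)))"
    by (simp add: sum_distrib_left sum_distrib_right mult.assoc) (rule sum.swap)
  also have "\<dots> = (\<Sum>w<n. (\<Sum>v<n. U $$ (i, v) * ?c (B $$ (v, w))) * ?c (?V $$ (w, k)))"
    using Suc.prems by (simp add: AU)
  also have "\<dots> = (\<Sum>v<n. U $$ (i, v) * (\<Sum>w<n. ?c (B $$ (v, w)) * ?c (?V $$ (w, k))))"
    by (simp add: sum_distrib_left sum_distrib_right mult.assoc) (rule sum.swap)
  also have "\<dots> = (\<Sum>v<n. U $$ (i, v) * ?c (?V $$ (v, Suc k)))"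
    by (simp add: stepB gauss_hom.hom_sum gauss_hom.hom_mult)
  finally show ?case .
qed

text \<open>Both \<open>U\<close> and its conjugate with rows permuted by \<open>f\<close> and columns permuted by \<open>h\<close> carry the
  invertible walk matrix \<open>V\<close> to \<open>W\<close>, hence they agree.\<close>

lemma unitary_perm_cnj:
  fixes U W V :: "complex mat"
  assumes U: "U \<in> carrier_mat n n" and V: "V \<in> carrier_mat n n" and dV: "det V \<noteq> 0"
    and UV: "\<And>i k. i < n \<Longrightarrow> k < n \<Longrightarrow> W $$ (i, k) = (\<Sum>v<n. U $$ (i, v) * V $$ (v, k))"
    and f: "bij_betw f {..<n} {..<n}" and h: "bij_betw h {..<n} {..<n}"
    and Wf: "\<And>u k. u < n \<Longrightarrow> k < n \<Longrightarrow> W $$ (f u, k) = cnj (W $$ (u, k))"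
    and Vh: "\<And>u k. u < n \<Longrightarrow> k < n \<Longrightarrow> V $$ (h u, k) = cnj (V $$ (u, k))"
    and uv: "u < n" "v < n"
  shows "U $$ (f u, h v) = cnj (U $$ (u, v))"
proof -
  have fu: "f u < n"
    using f uv by (auto simp: bij_betw_def)
  define D where "D x = U $$ (f u, h x) - cnj (U $$ (u, x))" for x
  have "(\<Sum>x<n. D x * V $$ (h x, k)) = 0" if k: "k < n" for k
  proof -
    have "(\<Sum>x<n. U $$ (f u, h x) * V $$ (h x, k)) = (\<Sum>x<n. U $$ (f u, x) * V $$ (x, k))"
      by (rule sum.reindex_bij_betw[OF h])
    also have "\<dots> = cnj (W $$ (u, k))"
      using UV[OF fu k] Wf[OF uv(1) k] by simp
    also have "\<dots> = (\<Sum>x<n. cnj (U $$ (u, x)) * V $$ (h x, k))"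
      using k uv by (simp add: UV Vh)
    finally show ?thesis
      by (simp add: D_def left_diff_distrib sum_subtractf)
  qed
  \<comment> \<open>Multiplying the zero row by column \<open>h v\<close> of the adjugate isolates
    \<open>D v * det V\<close>.\<close>
  then have "(\<Sum>k<n. (\<Sum>x<n. D x * V $$ (h x, k)) * adj_mat V $$ (k, h v)) = 0"
    by simp
  moreover have "(\<Sum>k<n. (\<Sum>x<n. D x * V $$ (h x, k)) * adj_mat V $$ (k, h v))
      = (\<Sum>x<n. D x * (\<Sum>k<n. V $$ (h x, k) * adj_mat V $$ (k, h v)))"
    by (simp add: sum_distrib_left sum_distrib_right mult.assoc) (rule sum.swap)
  moreover have "\<dots> = (\<Sum>x<n. if x = v then D v * det V else 0)"
  proof (rule sum.cong)
    fix x assume "x \<in> {..<n}"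
    then have "h x < n" "h v < n" "h x = h v \<longleftrightarrow> x = v"
      using h uv by (auto simp: bij_betw_def inj_on_def)
    then show "D x * (\<Sum>k<n. V $$ (h x, k) * adj_mat V $$ (k, h v)) = (if x = v then D v * det V else 0)"
      by (simp add: adj_mat_mult_index[OF V])
  qed simp
  ultimately show ?thesis
    using dV uv by (simp add: D_def)
qed

theorem theorem23:
  fixes n :: nat and G :: mixed_graph and W :: "gauss_int mat"
    and U :: "complex mat" and p :: gauss_int
  assumes "G \<in> self_converse_graphs n"
    and "W = walk_mat n (herm_adj_mat n G)"
    and "det W \<noteq> 0"
    and "U \<in> unitary_set n G"
    and "prime_elem p"
    and "gauss_odd p"
    and "\<not> p\<^sup>2 dvd det W"
  shows "\<not> p dvd level U"
proof
  assume pl: "p dvd level U"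
  let ?c = complex_of_gauss
  define A where "A = herm_adj_mat n G"
  define l where "l = level U"
  from assms(4) obtain H where H: "H \<in> self_converse_graphs n"
    and UAU: "mat_adjoint U * map_mat ?c A * U = map_mat ?c (herm_adj_mat n H)"
    and U: "U \<in> carrier_mat n n" and rat: "elements_mat U \<subseteq> Gauss_Rats"
    and uni: "mat_adjoint U * U = 1\<^sub>m n" "U * mat_adjoint U = 1\<^sub>m n"
    and Ue: "U *\<^sub>v ones_vec n = ones_vec n"
    by (auto simp: unitary_set_def gauss_rat_unitary_def A_def)
  define B where "B = herm_adj_mat n H"
  define V where "V = walk_mat n B"
  have A: "A \<in> carrier_mat n n" and B: "B \<in> carrier_mat n n"
    by (simp_all add: A_def B_def herm_adj_mat_carrier)
  have W_def: "W = walk_mat n A"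
    using assms(2) by (simp add: A_def)
  have W: "W \<in> carrier_mat n n" and V: "V \<in> carrier_mat n n"
    by (simp_all add: W_def V_def walk_mat_carrier)
  have Us: "mat_adjoint U \<in> carrier_mat n n"
    using mat_adjoint_carrier[OF U] .
  have cA: "map_mat ?c A \<in> carrier_mat n n" and cB: "map_mat ?c B \<in> carrier_mat n n"
    using A B by simp_all
  have orth: "(\<Sum>k<n. cnj (U $$ (k, i)) * U $$ (k, j)) = (if i = j then 1 else 0)"
    if "i < n" "j < n" for i j
    using mat_mult_index_sum[OF Us U that] uni(1) that by (simp add: mat_adjoint_index[OF U])
  have Ue': "(\<Sum>k<n. U $$ (i, k)) = 1" if "i < n" for i
    using mult_mat_vec_index_sum[OF U _ that, of "ones_vec n"] Ue that by (simp add: ones_vec_def)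
  have "map_mat ?c A * U = (U * mat_adjoint U) * (map_mat ?c A * U)"
    using cA U by (simp add: uni)
  also have "\<dots> = U * (mat_adjoint U * map_mat ?c A * U)"
    using cA U Us by (simp add: assoc_mult_mat[of _ n n _ n _ n])
  finally have AUB: "map_mat ?c A * U = U * map_mat ?c B"
    by (simp add: UAU B_def)
  have AU: "(\<Sum>k<n. ?c (A $$ (i, k)) * U $$ (k, j)) = (\<Sum>k<n. U $$ (i, k) * ?c (B $$ (k, j)))"
    if "i < n" "j < n" for i j
    using mat_mult_index_sum[OF cA U that] mat_mult_index_sum[OF U cB that] AUB A B that by simp
  have WUV: "?c (W $$ (i, k)) = (\<Sum>v<n. U $$ (i, v) * ?c (V $$ (v, k)))" if "i < n" "k < n" for i k
    unfolding W_def V_def by (rule unitary_walk_mat[OF A B Ue' AU that])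
  have "map_mat ?c W = U * map_mat ?c V"
    using W V U by (intro eq_matI) (auto simp: WUV mat_mult_index_sum[of U n n "map_mat ?c V" n]
        simp del: index_mult_mat(1))
  then have "?c (det W) = det U * ?c (det V)"
    using det_mult[OF U, of "map_mat ?c V"] V by (metis gauss_hom.hom_det map_carrier_mat)
  then have dV: "det (map_mat ?c V) \<noteq> 0"
    using assms(3) by auto
  obtain f where f: "bij_betw f {..<n} {..<n}"
    and Af: "\<And>u v. u < n \<Longrightarrow> v < n \<Longrightarrow> A $$ (f u, f v) = gauss_cnj (A $$ (u, v))"
    using self_converse_perm[OF assms(1)] unfolding A_def by blast
  obtain h where h: "bij_betw h {..<n} {..<n}"
    and Bh: "\<And>u v. u < n \<Longrightarrow> v < n \<Longrightarrow> B $$ (h u, h v) = gauss_cnj (B $$ (u, v))"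
    using self_converse_perm[OF H] unfolding B_def by blast
  have fn: "f u < n" "h u < n" if "u < n" for u
    using f h that by (auto simp: bij_betw_def)
  have Wf: "?c (W $$ (f u, k)) = cnj (?c (W $$ (u, k)))" if "u < n" "k < n" for u k
    unfolding W_def by (rule walk_mat_cnj[OF A f Af that])
  have Vh: "?c (V $$ (h u, k)) = cnj (?c (V $$ (u, k)))" if "u < n" "k < n" for u k
    unfolding V_def by (rule walk_mat_cnj[OF B h Bh that])
  have Ufh: "U $$ (f u, h v) = cnj (U $$ (u, v))" if "u < n" "v < n" for u v
    using W V fn by (intro unitary_perm_cnj[OF U _ dV _ f h _ _ that, of "map_mat ?c W"])
      (auto simp: WUV[symmetric] Wf Vh)

  have lev: "gauss_integral_mat (?c l \<cdot>\<^sub>m U)"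
    using is_level_level[OF rat] by (simp add: is_level_def l_def)
  then have "\<forall>i<n. \<forall>j<n. \<exists>m. ?c m = ?c l * U $$ (i, j)"
    using U by (fastforce simp: gauss_integral_mat_smult_iff)
  then obtain M where M: "\<And>i j. i < n \<Longrightarrow> j < n \<Longrightarrow> ?c (M i j) = ?c l * U $$ (i, j)"
    by metis
  \<comment> \<open>\<open>g\<close> inverts \<open>f\<close>, so \<open>Y\<close> is
    \<open>M\<close> with row \<open>u\<close> moved to position \<open>f u\<close>.\<close>
  define g where "g = the_inv_into {..<n} f"
  define Y where "Y i j = M (g i) j" for i j
  have gf: "g (f u) = u" if "u < n" for u
    using f that by (simp add: g_def bij_betw_def the_inv_into_f_f)
  have Y: "Y (f u) j = M u j" if "u < n" for u j
    by (simp add: Y_def gf that)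
  obtain b j where bj: "b < n" "j < n" "\<not> p dvd M b j"
    using level_not_divisible[OF rat assms(5) pl, of M] M U by (auto simp: l_def)
  have "p\<^sup>2 dvd det W"
  proof (rule krylov_prime_square_dvd_det[where A = "\<lambda>i j. A $$ (i, j)" and B = "\<lambda>i j. B $$ (i, j)"
        and M = M and Y = Y and f = f and b = b and j = j])
    show "krylov_mat n (\<lambda>i j. A $$ (i, j)) W"
      unfolding W_def by (rule walk_mat_krylov[OF A])
    show "Y (f u) j = M u j" if "u < n" "j < n" for u j
      by (rule Y[OF that(1)])
    show "A $$ (f u, f v) = A $$ (v, u)" if "u < n" "v < n" for u v
      using herm_adj_mat_cnj[of G n u v] Af[OF that] assms(1) that
      by (simp add: A_def self_converse_graphs_def)
    show "(\<Sum>k<n. A $$ (i, k) * M k j) = (\<Sum>k<n. M i k * B $$ (k, j))" if "i < n" "j < n" for i j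
    proof -
      have "?c (\<Sum>k<n. A $$ (i, k) * M k j) = ?c l * (\<Sum>k<n. ?c (A $$ (i, k)) * U $$ (k, j))"
        using that by (simp add: gauss_hom.hom_sum gauss_hom.hom_mult M sum_distrib_left mult.left_commute)
      also have "\<dots> = ?c (\<Sum>k<n. M i k * B $$ (k, j))"
        using that by (simp add: AU gauss_hom.hom_sum gauss_hom.hom_mult M sum_distrib_left mult.assoc)
      finally show ?thesis
        by simp
    qed
    show "p dvd (\<Sum>i<n. Y i j * W $$ (i, k))" if "j < n" "k < n" for j k
    proof -
      \<comment> \<open>Row \<open>f u\<close> of \<open>W\<close> is the conjugate of row
        \<open>u\<close>, so the sum is \<open>l\<close> times the conjugate of an entry of the
        adjoint of \<open>U\<close> times \<open>W\<close>, which is \<open>V\<close>.\<close>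
      have "?c (\<Sum>i<n. Y i j * W $$ (i, k)) = (\<Sum>u<n. ?c (M u j) * ?c (W $$ (f u, k)))"
        by (subst sum.reindex_bij_betw[OF f, symmetric])
          (simp add: Y gauss_hom.hom_sum gauss_hom.hom_mult)
      also have "\<dots> = ?c l * cnj (\<Sum>u<n. cnj (U $$ (u, j)) * ?c (W $$ (u, k)))"
        using that by (simp add: M Wf sum_distrib_left mult.assoc)
      also have "(\<Sum>u<n. cnj (U $$ (u, j)) * ?c (W $$ (u, k)))
          = (\<Sum>v<n. (\<Sum>u<n. cnj (U $$ (u, j)) * U $$ (u, v)) * ?c (V $$ (v, k)))"
        using that by (simp add: WUV sum_distrib_left sum_distrib_right mult.assoc) (rule sum.swap)
      also have "\<dots> = ?c (V $$ (j, k))"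
        using that by (simp add: orth if_distrib[of "\<lambda>x. x * _"] cong: if_cong)
      finally have "?c (\<Sum>i<n. Y i j * W $$ (i, k)) = ?c (l * gauss_cnj (V $$ (j, k)))"
        by (simp add: gauss_hom.hom_mult)
      then show ?thesis
        using pl by (simp add: l_def)
    qed
    show "p\<^sup>2 dvd (\<Sum>w<n. Y w i * M w j)" if ij: "i < n" "j < n" for i j
    proof -
      \<comment> \<open>Writing the column as \<open>h j'\<close> lets both permutations act at
        once: the entry of \<open>U\<close> at \<open>(f u, h j')\<close> is the conjugate of that
        at \<open>(u, j')\<close>, and orthonormal columns leave \<open>l^2\<close> or 0.\<close>
      obtain j' where j': "j' < n" "j = h j'"
        using h ij(2) by (auto simp: bij_betw_def)
      have "?c (\<Sum>w<n. Y w i * M w j) = (\<Sum>u<n. ?c (M u i) * ?c (M (f u) j))"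
        by (subst sum.reindex_bij_betw[OF f, symmetric])
          (simp add: Y gauss_hom.hom_sum gauss_hom.hom_mult)
      also have "\<dots> = ?c l * ?c l * (\<Sum>u<n. cnj (U $$ (u, j')) * U $$ (u, i))"
        using ij j' by (simp add: M fn Ufh sum_distrib_left mult_ac)
      also have "\<dots> = ?c (l\<^sup>2 * (if j' = i then 1 else 0))"
        using ij j' by (simp add: orth gauss_hom.hom_mult power2_eq_square)
      finally show ?thesis
        using pl by (simp add: l_def dvd_power_same)
    qed
  qed (use assms(5) f bj in simp_all)
  with assms(7) show False
    by contradiction
qed

end
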